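(* Let $M$ be a matroid on a finite set $S$ with support lattice $\mathcal{L}$ the Boolean lattice of subsets of $S$. Every Crapo-Tutte partition of $\mathcal{L}$ is a Tutte partition of $M$.
   Context: A matroid is $M=(\mathcal{L},r)$, where $\mathcal{L}$ is the lattice of all subsets of a finite set $S$ (ordered by inclusion, $\mathbf{0}=\emptyset$, $\mathbf{1}=S$), and $r:\mathcal{L}\to\mathbb{Z}_{\ge0}$ satisfies $0\le r(x)\le |x|$, monotonicity and submodularity. $\mathrm{h}(x)=|x|$. A basis is a set $b$ with $r(b)=|b|=r(\mathbf{1})$. Crapo-Tutte partition: let $\beta$ be a total ordering of the bases of $M$. For an interval, the $\beta$-max (resp. $\beta$-min) basis is the maximum (resp. minimum), with respect to $\beta$, of the bases of $M$ lying in that interval. A partition $\mathcal{P}$ of $\mathcal{L}$ into intervals is a Crapo-Tutte partition (with respect to such a $\beta$) if for every $[x,y]\in\mathcal{P}$: (1) there is exactly one basis $b$ of $M$ in $[x,y]$; (2) $b$ is the $\beta$-max basis of $[x,\mathbf{1}]$; (3) $b$ is the $\beta$-min basis of $[\mathbf{0},y]$. Tutte partition: a diamond is an interval $[a,b]$ with $\mathrm{h}(b)-\mathrm{h}(a)=2$; it is prime if $r(x)-r(a)=1$ and $r(b)-r(x)=0$ for every $a<x<b$. An interval is prime-free if it contains no prime diamond as a subinterval. A Tutte partition of $M$ is a partition of $\mathcal{L}$ into intervals such that every part $[a,b]$ satisfies $r(a)=\mathrm{h}(a)$, $r(b)=r(\mathbf{1})$, and is prime-free. *)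

theory Defs
  imports Main "HOL-Library.Disjoint_Sets"
begin

text \<open>The support lattice is \<^term>\<open>Pow S\<close>, with height function \<^const>\<open>card\<close>.  The values of the rank
  function outside \<^term>\<open>Pow S\<close> are unconstrained and never used.\<close>

locale matroid =
  fixes S :: "'a set" and r :: "'a set \<Rightarrow> nat"
  assumes finite_ground: "finite S"
    and rank_le_card: "x \<subseteq> S \<Longrightarrow> r x \<le> card x"
    and rank_mono: "x \<subseteq> y \<Longrightarrow> y \<subseteq> S \<Longrightarrow> r x \<le> r y"
    and rank_submodular: "x \<subseteq> S \<Longrightarrow> y \<subseteq> S \<Longrightarrow> r (x \<union> y) + r (x \<inter> y) \<le> r x + r y"

definition bases :: "'a set \<Rightarrow> ('a set \<Rightarrow> nat) \<Rightarrow> 'a set set" where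
  "bases S r = {b. b \<subseteq> S \<and> r b = card b \<and> r b = r S}"

definition interval_partition :: "'a set \<Rightarrow> 'a set set set \<Rightarrow> bool" where
  "interval_partition S P \<longleftrightarrow>
     partition_on (Pow S) P \<and> (\<forall>I\<in>P. \<exists>x y. x \<subseteq> y \<and> y \<subseteq> S \<and> I = {x..y})"

text \<open>A total ordering of the bases is a reflexive relation \<open>\<beta>\<close>, where \<open>(b, b') \<in> \<beta>\<close>
  means that \<open>b\<close> is at most \<open>b'\<close>.\<close>

definition is_max_basis ::
  "'a set \<Rightarrow> ('a set \<Rightarrow> nat) \<Rightarrow> 'a set rel \<Rightarrow> 'a set set \<Rightarrow> 'a set \<Rightarrow> bool" where
  "is_max_basis S r \<beta> I b \<longleftrightarrow>
     b \<in> bases S r \<inter> I \<and> (\<forall>b'\<in>bases S r \<inter> I. (b', b) \<in> \<beta>)"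

definition is_min_basis ::
  "'a set \<Rightarrow> ('a set \<Rightarrow> nat) \<Rightarrow> 'a set rel \<Rightarrow> 'a set set \<Rightarrow> 'a set \<Rightarrow> bool" where
  "is_min_basis S r \<beta> I b \<longleftrightarrow>
     b \<in> bases S r \<inter> I \<and> (\<forall>b'\<in>bases S r \<inter> I. (b, b') \<in> \<beta>)"

definition crapo_tutte_partition_wrt ::
  "'a set \<Rightarrow> ('a set \<Rightarrow> nat) \<Rightarrow> 'a set rel \<Rightarrow> 'a set set set \<Rightarrow> bool" where
  "crapo_tutte_partition_wrt S r \<beta> P \<longleftrightarrow>
     interval_partition S P \<and>
     (\<forall>x y. x \<subseteq> y \<longrightarrow> {x..y} \<in> P \<longrightarrow>
        (\<exists>b. bases S r \<inter> {x..y} = {b} \<and>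
             is_max_basis S r \<beta> {x..S} b \<and>
             is_min_basis S r \<beta> {{}..y} b))"

definition crapo_tutte_partition ::
  "'a set \<Rightarrow> ('a set \<Rightarrow> nat) \<Rightarrow> 'a set set set \<Rightarrow> bool" where
  "crapo_tutte_partition S r P \<longleftrightarrow>
     (\<exists>\<beta>. linear_order_on (bases S r) \<beta> \<and> crapo_tutte_partition_wrt S r \<beta> P)"

text \<open>Differences of heights and ranks are taken in the integers, since subtraction of natural
  numbers is truncated.\<close>

definition diamond :: "'a set \<Rightarrow> 'a set \<Rightarrow> bool" where
  "diamond a b \<longleftrightarrow> a \<subseteq> b \<and> int (card b) - int (card a) = 2"

definition prime_diamond :: "('a set \<Rightarrow> nat) \<Rightarrow> 'a set \<Rightarrow> 'a set \<Rightarrow> bool" where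
  "prime_diamond r a b \<longleftrightarrow> diamond a b \<and>
     (\<forall>x. a \<subset> x \<and> x \<subset> b \<longrightarrow> int (r x) - int (r a) = 1 \<and> int (r b) - int (r x) = 0)"

definition prime_free :: "('a set \<Rightarrow> nat) \<Rightarrow> 'a set \<Rightarrow> 'a set \<Rightarrow> bool" where
  "prime_free r a b \<longleftrightarrow> \<not> (\<exists>c d. {c..d} \<subseteq> {a..b} \<and> prime_diamond r c d)"

definition tutte_partition ::
  "'a set \<Rightarrow> ('a set \<Rightarrow> nat) \<Rightarrow> 'a set set set \<Rightarrow> bool" where
  "tutte_partition S r P \<longleftrightarrow>
     interval_partition S P \<and>
     (\<forall>a b. a \<subseteq> b \<longrightarrow> {a..b} \<in> P \<longrightarrow> r a = card a \<and> r b = r S \<and> prime_free r a b)"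

end

theory Submission
  imports Defs
begin

text \<open>
  Let \<open>{x..y}\<close> be a part and \<open>b\<close> the one basis in it.  Since \<open>x \<subseteq> b\<close>, the set \<open>x\<close> is independent, and
  since \<open>b \<subseteq> y\<close>, the set \<open>y\<close> is spanning.  An independent set can be extended to a basis inside any
  spanning set containing it, so every independent set between \<open>x\<close> and \<open>y\<close> lies in a basis between
  \<open>x\<close> and \<open>y\<close>, that is, in \<open>b\<close>.  In other words, the minor on \<open>y - x\<close> consists of loops and coloops
  only, and the rank on \<open>{x..y}\<close> is the modular function \<open>z \<mapsto> card (b \<inter> z)\<close>
  (\<open>rank_eq_card_if_unique_basis\<close>).  A prime diamond is a place where the rank fails to be modular:
  for its two middle elements \<open>p\<close> and \<open>q\<close>, the rank of \<open>p\<close> plus the rank of \<open>q\<close> exceeds the rank of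
  \<open>p \<union> q\<close> plus the rank of \<open>p \<inter> q\<close> by one.  So there is none in a part.
\<close>

context matroid
begin

text \<open>Adding a set to \<open>a\<close> raises the rank by at most the size of that set, so a subset \<open>a\<close> with
  deficient rank would leave \<open>b\<close> deficient.\<close>

lemma subset_independent:
  assumes "a \<subseteq> b" "b \<subseteq> S" "r b = card b"
  shows "r a = card a"
proof -
  have fin: "finite b" using assms(2) finite_ground by (rule finite_subset)
  have "a \<subseteq> S" "b - a \<subseteq> S" using assms by auto
  moreover have "a \<union> (b - a) = b" using assms(1) by auto
  ultimately have "card b \<le> r a + r (b - a)"
    using rank_submodular[of a "b - a"] assms(3) by simp
  moreover have "r a \<le> card a" "r (b - a) \<le> card (b - a)"
    using rank_le_card \<open>a \<subseteq> S\<close> \<open>b - a \<subseteq> S\<close> by auto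
  moreover have "card b = card a + card (b - a)"
    using fin assms(1) by (simp add: card_Diff_subset card_mono finite_subset)
  ultimately show ?thesis by linarith
qed

text \<open>By submodularity, elements that do not raise the rank one at a time do not raise it together:
  this is the idempotence of the closure operator.\<close>

lemma rank_eq_if_insert_le:
  assumes "i \<subseteq> z" "z \<subseteq> S" and insert_le: "\<And>e. e \<in> z \<Longrightarrow> r (insert e i) \<le> r i"
  shows "r z = r i"
proof -
  have "r (i \<union> t) \<le> r i" if "finite t" "t \<subseteq> z" for t
    using that
  proof (induction t rule: finite_induct)
    case empty
    show ?case by simp
  next
    case (insert e t)
    have sub: "i \<union> t \<subseteq> S" "insert e i \<subseteq> S" using insert.prems assms(1,2) by auto
    have "i \<union> insert e t = (i \<union> t) \<union> insert e i" by auto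
    moreover have "r i \<le> r ((i \<union> t) \<inter> insert e i)"
      using sub by (intro rank_mono) auto
    ultimately show ?case
      using rank_submodular[OF sub] insert insert_le[of e] by auto
  qed
  moreover have "finite z" using assms(2) finite_ground by (rule finite_subset)
  moreover have "i \<union> z = z" using assms(1) by auto
  ultimately have "r z \<le> r i" by (metis order_refl)
  then show ?thesis using rank_mono[OF assms(1,2)] by simp
qed

lemma independent_extension:
  assumes "x \<subseteq> z" "z \<subseteq> S" "r x = card x"
  obtains i where "x \<subseteq> i" "i \<subseteq> z" "r i = card i" "r i = r z"
proof -
  \<comment> \<open>a maximal independent set between \<open>x\<close> and \<open>z\<close> has the rank of \<open>z\<close>\<close>
  define F where "F = {i. x \<subseteq> i \<and> i \<subseteq> z \<and> r i = card i}"
  have finz: "finite z" using assms(2) finite_ground by (rule finite_subset)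
  have "finite F" by (rule finite_subset[of _ "Pow z"]) (use finz in \<open>auto simp: F_def\<close>)
  moreover have "F \<noteq> {}" using assms by (auto simp: F_def)
  ultimately obtain i where "i \<in> F" and max: "\<forall>j\<in>F. i \<subseteq> j \<longrightarrow> i = j"
    using finite_has_maximal[of F] by metis
  then have i: "x \<subseteq> i" "i \<subseteq> z" "r i = card i" unfolding F_def by simp_all
  have fini: "finite i" using i(2) finz by (rule finite_subset)
  have "r (insert e i) \<le> r i" if "e \<in> z" for e
  proof (rule ccontr)
    assume gt: "\<not> r (insert e i) \<le> r i"
    then have "e \<notin> i" by (metis insert_absorb order_refl)
    have sub: "x \<subseteq> insert e i" "insert e i \<subseteq> z" using i that by blast+
    have "r (insert e i) \<le> card (insert e i)"
      using sub(2) assms(2) by (intro rank_le_card) (rule order_trans)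
    \<comment> \<open>so adding \<open>e\<close> keeps \<open>i\<close> independent, against its maximality\<close>
    then have "r (insert e i) = card (insert e i)"
      using gt i(3) fini \<open>e \<notin> i\<close> by simp
    then have "insert e i \<in> F" using sub unfolding F_def by simp
    then show False using max \<open>e \<notin> i\<close> by blast
  qed
  then have "r z = r i" using rank_eq_if_insert_le i(2) assms(2) by blast
  then show ?thesis using that i by simp
qed

lemma basis_in_interval:
  assumes "b \<in> bases S r \<inter> {x..y}"
  shows "b \<subseteq> S" "r b = card b" "r b = r S" "x \<subseteq> b" "b \<subseteq> y"
  using assms unfolding bases_def by simp_all

text \<open>An independent set between \<open>x\<close> and \<open>z\<close> of the same rank as \<open>z\<close> extends to a basis within
  \<open>y\<close>; by uniqueness this basis is \<open>b\<close>, so the independent set lies in \<open>b \<inter> z\<close>.  Hence \<open>b \<inter> z\<close>, which is independent, is as large as the rank of \<open>z\<close> allows.\<close>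

lemma rank_eq_card_if_unique_basis:
  assumes unique: "bases S r \<inter> {x..y} = {b}" and "y \<subseteq> S" "x \<subseteq> z" "z \<subseteq> y"
  shows "r z = card (b \<inter> z)"
proof (rule antisym)
  have b: "b \<subseteq> S" "r b = card b" "r b = r S" "x \<subseteq> b" "b \<subseteq> y"
    using basis_in_interval[of b x y] unique by simp_all
  have zS: "z \<subseteq> S" using assms by auto
  have "r x = card x" using subset_independent b by blast
  then obtain i where i: "x \<subseteq> i" "i \<subseteq> z" "r i = card i" "r i = r z"
    by (rule independent_extension[OF assms(3) zS])
  have "i \<subseteq> y" using i(2) assms(4) by auto
  then obtain j where j: "i \<subseteq> j" "j \<subseteq> y" "r j = card j" "r j = r y"
    using assms(2) i(3) by (rule independent_extension)
  have "r y = r S" using rank_mono[of b y] rank_mono[of y S] b assms(2) by simp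
  moreover have "j \<subseteq> S" "x \<subseteq> j" using j(1,2) i(1) assms(2) by blast+
  ultimately have "j \<in> bases S r \<inter> {x..y}" using j unfolding bases_def by simp
  then have "j = b" unfolding unique by simp
  then have "i \<subseteq> b \<inter> z" using j(1) i(2) by simp
  moreover have "finite (b \<inter> z)" using b(1) finite_ground finite_subset by blast
  ultimately show "r z \<le> card (b \<inter> z)" using card_mono i(3,4) by metis
  have "r (b \<inter> z) = card (b \<inter> z)" using subset_independent[of "b \<inter> z" b] b by simp
  then show "card (b \<inter> z) \<le> r z" using rank_mono[of "b \<inter> z" z] zS by simp
qed

text \<open>If \<open>p\<close> and \<open>q\<close> are the two middle elements of a diamond \<open>{c..d}\<close>, then modularity of
  \<open>z \<mapsto> card (b \<inter> z)\<close> gives \<open>r p + r q = r d + r c\<close>, whereas in a prime diamond the left side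
  is \<open>2 * r c + 2\<close> and the right side is \<open>2 * r c + 1\<close>.\<close>

lemma prime_free_if_unique_basis:
  assumes unique: "bases S r \<inter> {x..y} = {b}" and "y \<subseteq> S"
  shows "prime_free r x y"
  unfolding prime_free_def
proof (intro notI, elim exE conjE)
  fix c d
  assume sub: "{c..d} \<subseteq> {x..y}" and prime: "prime_diamond r c d"
  have "c \<subseteq> d" and height: "int (card d) - int (card c) = 2"
    using prime unfolding prime_diamond_def diamond_def by auto
  then have cd: "x \<subseteq> c" "c \<subseteq> d" "d \<subseteq> y" using sub by auto
  have find: "finite d" using cd assms(2) finite_ground by (meson finite_subset)
  then have "card (d - c) = 2"
    using height cd by (simp add: card_Diff_subset finite_subset)
  then obtain e f where ef: "d - c = {e, f}" "e \<noteq> f" by (auto simp: card_2_iff)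
  then have mem: "e \<in> d" "f \<in> d" "e \<notin> c" "f \<notin> c" by blast+
  let ?p = "insert e c" and ?q = "insert f c"
  have mid: "c \<subset> ?p" "?p \<subset> d" "c \<subset> ?q" "?q \<subset> d" using mem ef(2) cd by blast+
  have rank: "r z = card (b \<inter> z)" if "c \<subseteq> z" "z \<subseteq> d" for z
    using rank_eq_card_if_unique_basis[OF assms, of z] that cd by (meson order_trans)
  have "?p \<union> ?q = d" "?p \<inter> ?q = c" using ef cd by auto
  then have "(b \<inter> ?p) \<union> (b \<inter> ?q) = b \<inter> d" "(b \<inter> ?p) \<inter> (b \<inter> ?q) = b \<inter> c" by blast+
  moreover have "finite (b \<inter> ?p)" "finite (b \<inter> ?q)"
    using mid find by (auto dest: finite_subset)
  ultimately have "card (b \<inter> ?p) + card (b \<inter> ?q) = card (b \<inter> d) + card (b \<inter> c)"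
    by (metis card_Un_Int)
  then have "r ?p + r ?q = r d + r c"
    using rank[of ?p] rank[of ?q] rank[of d] rank[of c] mem cd by (simp add: subset_insertI)
  moreover have "int (r ?p) - int (r c) = 1" "int (r ?q) - int (r c) = 1"
    "int (r d) - int (r ?p) = 0"
    using prime mid unfolding prime_diamond_def by blast+
  ultimately show False by linarith
qed

end

theorem corollary88:
  fixes S :: "'a set" and r :: "'a set \<Rightarrow> nat" and P :: "'a set set set"
  assumes "matroid S r"
    and "crapo_tutte_partition S r P"
  shows "tutte_partition S r P"
proof -
  interpret matroid S r by fact
  have part: "interval_partition S P"
    using assms(2) unfolding crapo_tutte_partition_def crapo_tutte_partition_wrt_def by blast
  have unique: "\<exists>b. bases S r \<inter> {x..y} = {b}" if "x \<subseteq> y" "{x..y} \<in> P" for x y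
    using assms(2) that unfolding crapo_tutte_partition_def crapo_tutte_partition_wrt_def by meson
  have "r x = card x \<and> r y = r S \<and> prime_free r x y" if xy: "x \<subseteq> y" "{x..y} \<in> P" for x y
  proof -
    obtain b where b: "bases S r \<inter> {x..y} = {b}" using unique[OF xy] ..
    have "\<Union>P = Pow S" using part unfolding interval_partition_def partition_on_def by auto
    moreover have "y \<in> {x..y}" using xy(1) by simp
    ultimately have yS: "y \<subseteq> S" using xy(2) by blast
    have b': "b \<subseteq> S" "r b = card b" "r b = r S" "x \<subseteq> b" "b \<subseteq> y"
      using basis_in_interval[of b x y] b by simp_all
    have "r x = card x" using subset_independent b' by blast
    moreover have "r y = r S" using rank_mono[of b y] rank_mono[of y S] b' yS by auto
    ultimately show ?thesis using prime_free_if_unique_basis[OF b yS] by simp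
  qed
  then show ?thesis using part unfolding tutte_partition_def by simp
qed

end
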